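(* Let $\pi$ be a deterministic Markov policy for the reduced MDP $\bar M$, i.e. $\pi_h(s,b)\in\mathcal A_h(s)\times\mathcal B^S$ for every augmented state $(s,b)$. Then for all $h\in[H+1]$ and all augmented states $(s,b)$: if $\bar V^\pi_h(s,b)>-\infty$, then $\bar C^\pi_h(s,b)\le b$.
   Context: Cost-accumulating MDP. Fix $H,m\in\mathbb N$. A finite-horizon tabular cost-accumulating MDP consists of: - a finite state set $\mathcal S=\{1,\dots,S\}$; - finite action sets $\mathcal A_h(s)$; - transitions $P_h(\cdot\mid s,a)$; - expected rewards $r_h(s,a)$; - deterministic costs $c_h(s,a)\in\mathbb R^m$; - an initial state $s_0$. Vector inequalities are componentwise. SR functions. Let $f:\mathbb R^m\times\mathbb R^m\to\mathbb R^m$ satisfy: - $f$ is associative; - $f$ is componentwise non-decreasing in each argument; - $f$ is $1$-Lipschitz in each argument for $\|\cdot\|_\infty$; - $f(0,x)=f(x,0)=x$. Let $g:[0,1]\to[0,1]$ satisfy $g(0)=0$. Write $f_{s'}y_{s'}=f(y_1,f(y_2,\dots,y_S))$. Assume $x\mapsto f_{s'}g(p_{s'})x_{s'}$ is $1$-Lipschitz for $\|\cdot\|_\infty$ for every probability vector $p$. SR cost of a deterministic history-dependent policy. $C^\pi_{H+1}\equiv0$ and $C^\pi_h(\tau_h)=c_h(s,a)+f_{s'}g(P_h(s'\mid s,a))C^\pi_{h+1}(\tau_h,a,s')$, where $\tau_h$ are histories $(s_1=s_0,a_1,\dots,s_h)$. Budget set. $\mathcal B$ is the finite set of all values $C^\pi_h(\tau_h)$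 over deterministic policies, $h\in[H+1]$ and histories $\tau_h$. Reduced MDP $\bar M$. Augmented states are $(s,b)$, $b\in\mathbb R^m$. The allowed augmented actions are $\bar{\mathcal A}_h(s,b)=\{(a,\mathbf b)\in\mathcal A_h(s)\times\mathcal B^S:c_h(s,a)+f_{s'}g(P_h(s'\mid s,a))b_{s'}\le b\}$. Playing $(a,\mathbf b)$ gives reward $r_h(s,a)$ and moves to $(s',b_{s'})$ with $s'\sim P_h(\cdot\mid s,a)$. Value of $\pi$ in $\bar M$. $\bar V^\pi_{H+1}(s,b)=0$ if $b\ge0$ and $-\infty$ otherwise. For $h\le H$ with $(a,\mathbf b)=\pi_h(s,b)$: - $\bar V^\pi_h(s,b)=-\infty$ if $(a,\mathbf b)\notin\bar{\mathcal A}_h(s,b)$; - otherwise $\bar V^\pi_h(s,b)=r_h(s,a)+\sum_{s':P_h(s'|s,a)>0}P_h(s'\mid s,a)\bar V^\pi_{h+1}(s',b_{s'})$. Cost of $\pi$ in $\bar M$. $\bar C^\pi_{H+1}\equiv0$ and $\bar C^\pi_h(s,b)=c_h(s,a)+f_{s'}g(P_h(s'\mid s,a))\bar C^\pi_{h+1}(s',b_{s'})$, with $(a,\mathbf b)=\pi_h(s,b)$. *)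

theory Defs
  imports "HOL-Analysis.Analysis" "HOL-Probability.Probability"
begin

text \<open>
  States are the natural numbers in \<open>{1..nstates M}\<close>: the SR aggregation below is
  order-dependent, as the binary function \<open>f\<close> need not be commutative.
  The order \<open>\<le>\<close> on \<open>real ^ 'm\<close> is the componentwise one, and \<^const>\<open>infnorm\<close>
  is the maximum norm.
\<close>

record ('a, 'm::finite) camdp =
  horizon :: nat
  nstates :: nat
  actions :: "nat \<Rightarrow> nat \<Rightarrow> 'a set"
  transition :: "nat \<Rightarrow> nat \<Rightarrow> 'a \<Rightarrow> nat pmf"
  reward :: "nat \<Rightarrow> nat \<Rightarrow> 'a \<Rightarrow> real"
  cost :: "nat \<Rightarrow> nat \<Rightarrow> 'a \<Rightarrow> real ^ 'm"
  init :: nat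

definition states :: "('a, 'm::finite) camdp \<Rightarrow> nat set" where
  "states M = {1..nstates M}"

definition is_camdp :: "('a, 'm::finite) camdp \<Rightarrow> bool" where
  "is_camdp M \<longleftrightarrow>
     init M \<in> states M \<and>
     (\<forall>h\<in>{1..horizon M}. \<forall>s\<in>states M.
        finite (actions M h s) \<and>
        (\<forall>a\<in>actions M h s. set_pmf (transition M h s a) \<subseteq> states M))"

text \<open>The value at the empty list is never used, since there is at least one state.\<close>

fun nested :: "('v::zero \<Rightarrow> 'v \<Rightarrow> 'v) \<Rightarrow> 'v list \<Rightarrow> 'v" where
  "nested f [] = 0"
| "nested f [x] = x"
| "nested f (x # y # ys) = f x (nested f (y # ys))"

definition sr_agg :: "nat \<Rightarrow> ('v::zero \<Rightarrow> 'v \<Rightarrow> 'v) \<Rightarrow> (nat \<Rightarrow> 'v) \<Rightarrow> 'v" where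
  "sr_agg S f y = nested f (map y [1..<Suc S])"

definition sr_functions ::
  "nat \<Rightarrow> (real ^ 'm::finite \<Rightarrow> real ^ 'm \<Rightarrow> real ^ 'm) \<Rightarrow> (real \<Rightarrow> real) \<Rightarrow> bool" where
  "sr_functions S f g \<longleftrightarrow>
     (\<forall>x y z. f (f x y) z = f x (f y z)) \<and>
     (\<forall>x x' y. x \<le> x' \<longrightarrow> f x y \<le> f x' y) \<and>
     (\<forall>x y y'. y \<le> y' \<longrightarrow> f x y \<le> f x y') \<and>
     (\<forall>x x' y. infnorm (f x y - f x' y) \<le> infnorm (x - x')) \<and>
     (\<forall>x y y'. infnorm (f x y - f x y') \<le> infnorm (y - y')) \<and>
     (\<forall>x. f 0 x = x \<and> f x 0 = x) \<and>
     g \<in> {0..1} \<rightarrow> {0..1} \<and> g 0 = 0 \<and>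
     (\<forall>p :: nat pmf. set_pmf p \<subseteq> {1..S} \<longrightarrow>
        (\<forall>x y :: nat \<Rightarrow> real ^ 'm.
           infnorm (sr_agg S f (\<lambda>s'. g (pmf p s') *\<^sub>R x s')
                    - sr_agg S f (\<lambda>s'. g (pmf p s') *\<^sub>R y s'))
             \<le> (MAX s'\<in>{1..S}. infnorm (x s' - y s'))))"

text \<open>\<open>Extend \<tau> a s'\<close> is the history \<open>(\<tau>, a, s')\<close>.\<close>

datatype 'a history = Start nat | Extend "'a history" 'a nat

primrec cur :: "'a history \<Rightarrow> nat" where
  "cur (Start s) = s"
| "cur (Extend \<tau> a s') = s'"

text \<open>\<open>is_history M h \<tau>\<close>: \<open>\<tau>\<close> is a history \<open>(s\<^sub>1, a\<^sub>1, \<dots>, s\<^sub>h)\<close> with \<open>h\<close> states.\<close>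

inductive is_history :: "('a, 'm::finite) camdp \<Rightarrow> nat \<Rightarrow> 'a history \<Rightarrow> bool"
  for M :: "('a, 'm) camdp" where
  start: "is_history M 1 (Start (init M))"
| extend: "is_history M h \<tau> \<Longrightarrow> h \<le> horizon M \<Longrightarrow> a \<in> actions M h (cur \<tau>) \<Longrightarrow> s' \<in> states M
    \<Longrightarrow> is_history M (Suc h) (Extend \<tau> a s')"

definition history_policy ::
  "('a, 'm::finite) camdp \<Rightarrow> (nat \<Rightarrow> 'a history \<Rightarrow> 'a) \<Rightarrow> bool" where
  "history_policy M \<pi> \<longleftrightarrow>
     (\<forall>h\<in>{1..horizon M}. \<forall>\<tau>. is_history M h \<tau> \<longrightarrow> \<pi> h \<tau> \<in> actions M h (cur \<tau>))"

function sr_cost ::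
  "('a, 'm::finite) camdp \<Rightarrow> (real ^ 'm \<Rightarrow> real ^ 'm \<Rightarrow> real ^ 'm) \<Rightarrow> (real \<Rightarrow> real) \<Rightarrow>
   (nat \<Rightarrow> 'a history \<Rightarrow> 'a) \<Rightarrow> nat \<Rightarrow> 'a history \<Rightarrow> real ^ 'm" where
  "sr_cost M f g \<pi> h \<tau> =
     (if horizon M < h then 0
      else let s = cur \<tau>; a = \<pi> h \<tau> in
        cost M h s a
        + sr_agg (nstates M) f
            (\<lambda>s'. g (pmf (transition M h s a) s') *\<^sub>R sr_cost M f g \<pi> (Suc h) (Extend \<tau> a s')))"
  by pat_completeness auto
termination
  by (relation "Wellfounded.measure (\<lambda>(M, f, g, \<pi>, h, \<tau>). Suc (horizon M) - h)") auto

declare sr_cost.simps [simp del]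

definition budget_set ::
  "('a, 'm::finite) camdp \<Rightarrow> (real ^ 'm \<Rightarrow> real ^ 'm \<Rightarrow> real ^ 'm) \<Rightarrow> (real \<Rightarrow> real) \<Rightarrow>
   (real ^ 'm) set" where
  "budget_set M f g =
     {sr_cost M f g \<pi> h \<tau> | \<pi> h \<tau>.
        history_policy M \<pi> \<and> h \<in> {1..horizon M + 1} \<and> is_history M h \<tau>}"

lemma finite_budget_set:
  fixes M :: "('a, 'm::finite) camdp"
  assumes "is_camdp M"
  shows "finite (budget_set M f g)"
proof -
  let ?H = "horizon M"
  have cur_state: "cur \<tau> \<in> states M" if "is_history M h \<tau>" for h \<tau>
    using that assms by (induction) (auto simp: is_camdp_def)
  have agg_cong: "sr_agg (nstates M) f y = sr_agg (nstates M) f z"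
    if "\<And>s. s \<in> states M \<Longrightarrow> y s = z s" for y z :: "nat \<Rightarrow> real ^ 'm"
    using that unfolding sr_agg_def states_def
    by (intro arg_cong[where f = "nested f"] map_cong) auto
  have step: "\<exists>F. finite F \<and> (\<forall>\<pi> \<tau>. history_policy M \<pi> \<longrightarrow> is_history M (Suc ?H - n) \<tau> \<longrightarrow>
                sr_cost M f g \<pi> (Suc ?H - n) \<tau> \<in> F)" if "n \<le> ?H" for n
    using that
  proof (induction n)
    case 0
    then show ?case by (intro exI[of _ "{0}"]) (auto simp: sr_cost.simps)
  next
    case (Suc n)
    define h where "h = ?H - n"
    have h: "1 \<le> h" "h \<le> ?H" "Suc h = Suc ?H - n" "Suc ?H - Suc n = h"
      using Suc.prems by (auto simp: h_def)
    from Suc obtain F where F: "finite F"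
      "\<And>\<pi> \<tau>. history_policy M \<pi> \<Longrightarrow> is_history M (Suc h) \<tau> \<Longrightarrow> sr_cost M f g \<pi> (Suc h) \<tau> \<in> F"
      using h by auto
    define X where "X = (SIGMA s:states M. actions M h s) \<times> (states M \<rightarrow>\<^sub>E F)"
    define \<Phi> where "\<Phi> = (\<lambda>((s, a), v). cost M h s a
      + sr_agg (nstates M) f (\<lambda>s'. g (pmf (transition M h s a) s') *\<^sub>R (v s' :: real ^ 'm)))"
    have fin_st: "finite (states M)" by (simp add: states_def)
    have "finite X"
      unfolding X_def using assms h F(1) fin_st
      by (intro finite_cartesian_product finite_SigmaI finite_PiE) (auto simp: is_camdp_def)
    moreover have "sr_cost M f g \<pi> h \<tau> \<in> \<Phi> ` X"
      if pi: "history_policy M \<pi>" and tau: "is_history M h \<tau>" for \<pi> \<tau>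
    proof -
      let ?s = "cur \<tau>" and ?a = "\<pi> h \<tau>"
      define v where "v = restrict (\<lambda>s'. sr_cost M f g \<pi> (Suc h) (Extend \<tau> ?a s')) (states M)"
      have a: "?a \<in> actions M h ?s" using pi tau h by (auto simp: history_policy_def)
      have "v \<in> states M \<rightarrow>\<^sub>E F"
        unfolding v_def using F(2)[OF pi] is_history.extend[OF tau h(2) a] by auto
      then have "((?s, ?a), v) \<in> X" using a cur_state[OF tau] by (auto simp: X_def)
      moreover have "sr_cost M f g \<pi> h \<tau> = \<Phi> ((?s, ?a), v)"
        using h(2) by (subst sr_cost.simps) (auto simp: \<Phi>_def v_def Let_def intro!: agg_cong)
      ultimately show ?thesis by blast
    qed
    ultimately show ?case using h(4) by (intro exI[of _ "\<Phi> ` X"]) auto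
  qed
  then obtain F where F: "\<And>n. n \<le> ?H \<Longrightarrow> finite (F n)"
    "\<And>n \<pi> \<tau>. n \<le> ?H \<Longrightarrow> history_policy M \<pi> \<Longrightarrow> is_history M (Suc ?H - n) \<tau> \<Longrightarrow>
       sr_cost M f g \<pi> (Suc ?H - n) \<tau> \<in> F n"
    by metis
  have "budget_set M f g \<subseteq> (\<Union>n\<le>?H. F n)"
  proof
    fix x assume "x \<in> budget_set M f g"
    then obtain \<pi> h \<tau> where x: "x = sr_cost M f g \<pi> h \<tau>" "history_policy M \<pi>"
      "h \<in> {1..?H + 1}" "is_history M h \<tau>"
      by (auto simp: budget_set_def)
    then have "x \<in> F (Suc ?H - h)"
      using F(2)[of "Suc ?H - h" \<pi> \<tau>] by auto
    then show "x \<in> (\<Union>n\<le>?H. F n)" using x(3) by auto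
  qed
  then show ?thesis by (rule finite_subset) (use F(1) in auto)
qed

definition budget_vectors ::
  "('a, 'm::finite) camdp \<Rightarrow> (real ^ 'm \<Rightarrow> real ^ 'm \<Rightarrow> real ^ 'm) \<Rightarrow> (real \<Rightarrow> real) \<Rightarrow>
   (nat \<Rightarrow> real ^ 'm) set" where
  "budget_vectors M f g = states M \<rightarrow>\<^sub>E budget_set M f g"

definition aug_actions ::
  "('a, 'm::finite) camdp \<Rightarrow> (real ^ 'm \<Rightarrow> real ^ 'm \<Rightarrow> real ^ 'm) \<Rightarrow> (real \<Rightarrow> real) \<Rightarrow>
   nat \<Rightarrow> nat \<Rightarrow> real ^ 'm \<Rightarrow> ('a \<times> (nat \<Rightarrow> real ^ 'm)) set" where
  "aug_actions M f g h s b =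
     {(a, bb) \<in> actions M h s \<times> budget_vectors M f g.
        cost M h s a + sr_agg (nstates M) f (\<lambda>s'. g (pmf (transition M h s a) s') *\<^sub>R bb s') \<le> b}"

type_synonym ('a, 'm) aug_policy =
  "nat \<Rightarrow> nat \<Rightarrow> real ^ 'm \<Rightarrow> 'a \<times> (nat \<Rightarrow> real ^ 'm)"

definition is_aug_policy ::
  "('a, 'm::finite) camdp \<Rightarrow> (real ^ 'm \<Rightarrow> real ^ 'm \<Rightarrow> real ^ 'm) \<Rightarrow> (real \<Rightarrow> real) \<Rightarrow>
   ('a, 'm) aug_policy \<Rightarrow> bool" where
  "is_aug_policy M f g \<pi> \<longleftrightarrow>
     (\<forall>h\<in>{1..horizon M}. \<forall>s\<in>states M. \<forall>b.
        \<pi> h s b \<in> actions M h s \<times> budget_vectors M f g)"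

text \<open>
  No value is ever \<open>\<infinity>\<close> (rewards are real), so the convention \<open>\<infinity> + - \<infinity> = \<infinity>\<close> of
  \<^typ>\<open>ereal\<close> plays no role: a single successor of positive probability with value
  \<open>- \<infinity>\<close> makes the value \<open>- \<infinity>\<close>.
\<close>

function aug_value ::
  "('a, 'm::finite) camdp \<Rightarrow> (real ^ 'm \<Rightarrow> real ^ 'm \<Rightarrow> real ^ 'm) \<Rightarrow> (real \<Rightarrow> real) \<Rightarrow>
   ('a, 'm) aug_policy \<Rightarrow> nat \<Rightarrow> nat \<Rightarrow> real ^ 'm \<Rightarrow> ereal" where
  "aug_value M f g \<pi> h s b =
     (if horizon M < h then (if 0 \<le> b then 0 else - \<infinity>)
      else let a = fst (\<pi> h s b); bb = snd (\<pi> h s b) in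
        if (a, bb) \<notin> aug_actions M f g h s b then - \<infinity>
        else ereal (reward M h s a)
          + (\<Sum>s' | s' \<in> states M \<and> pmf (transition M h s a) s' > 0.
               ereal (pmf (transition M h s a) s') * aug_value M f g \<pi> (Suc h) s' (bb s')))"
  by pat_completeness auto
termination
  by (relation "Wellfounded.measure (\<lambda>(M, f, g, \<pi>, h, s, b). Suc (horizon M) - h)") auto

declare aug_value.simps [simp del]

function aug_cost ::
  "('a, 'm::finite) camdp \<Rightarrow> (real ^ 'm \<Rightarrow> real ^ 'm \<Rightarrow> real ^ 'm) \<Rightarrow> (real \<Rightarrow> real) \<Rightarrow>
   ('a, 'm) aug_policy \<Rightarrow> nat \<Rightarrow> nat \<Rightarrow> real ^ 'm \<Rightarrow> real ^ 'm" where
  "aug_cost M f g \<pi> h s b =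
     (if horizon M < h then 0
      else let a = fst (\<pi> h s b); bb = snd (\<pi> h s b) in
        cost M h s a
        + sr_agg (nstates M) f
            (\<lambda>s'. g (pmf (transition M h s a) s') *\<^sub>R aug_cost M f g \<pi> (Suc h) s' (bb s')))"
  by pat_completeness auto
termination
  by (relation "Wellfounded.measure (\<lambda>(M, f, g, \<pi>, h, s, b). Suc (horizon M) - h)") auto

declare aug_cost.simps [simp del]

end

theory Submission
  imports Defs
begin

text \<open>
  Backward induction on the step. A finite value at \<open>(s, b)\<close> forces the chosen action to be
  allowed and the value to be finite at every successor \<open>(s', b\<^sub>s\<^sub>')\<close> of positive probability,
  where the cost is then at most \<open>b\<^sub>s\<^sub>'\<close>. Successors of probability \<open>0\<close> have weight \<open>g 0 = 0\<close>
  and contribute equally to both aggregates, so monotonicity of \<open>f\<close> bounds the cost by the left-hand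
  side of the constraint that defines the allowed actions.
\<close>

lemma nested_mono:
  fixes f :: "'v::{zero, preorder} \<Rightarrow> 'v \<Rightarrow> 'v"
  assumes "\<And>x x' y. x \<le> x' \<Longrightarrow> f x y \<le> f x' y"
    and "\<And>x y y'. y \<le> y' \<Longrightarrow> f x y \<le> f x y'"
    and "list_all2 (\<le>) xs ys"
  shows "nested f xs \<le> nested f ys"
  using assms(3)
proof (induction rule: list_all2_induct)
  case (Cons x xs y ys)
  show ?case
  \<comment> \<open>\<open>nested\<close> returns the element itself on a singleton instead of
    applying \<open>f\<close> to it, so the shape of the tail decides which equation
    applies.\<close>
  proof (cases xs)
    case Nil
    then show ?thesis using Cons.hyps by simp
  next
    case (Cons x' xs')
    with \<open>list_all2 (\<le>) xs ys\<close> obtain y' ys' where ys: "ys = y' # ys'"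
      by (auto simp: list_all2_Cons1)
    have "f x (nested f xs) \<le> f y (nested f xs)"
      using assms(1) \<open>x \<le> y\<close> .
    also have "\<dots> \<le> f y (nested f ys)"
      using assms(2) \<open>nested f xs \<le> nested f ys\<close> .
    finally show ?thesis using Cons ys by simp
  qed
qed simp

lemma sr_agg_mono:
  fixes f :: "'v::{zero, preorder} \<Rightarrow> 'v \<Rightarrow> 'v"
  assumes "\<And>x x' y. x \<le> x' \<Longrightarrow> f x y \<le> f x' y"
    and "\<And>x y y'. y \<le> y' \<Longrightarrow> f x y \<le> f x y'"
    and "\<And>s. s \<in> {1..S} \<Longrightarrow> x s \<le> y s"
  shows "sr_agg S f x \<le> sr_agg S f y"
  unfolding sr_agg_def
  using assms by (intro nested_mono) (auto simp: list_all2_conv_all_nth nth_append)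

text \<open>Rewards and weights are real and the terminal values are \<open>0\<close> or
  \<open>- \<infinity>\<close>. In \<open>ereal\<close>, \<open>\<infinity>\<close> absorbs
  \<open>- \<infinity>\<close>, so a value \<open>\<infinity>\<close> could hide an infeasible
  successor.\<close>

lemma aug_value_not_PInfty: "aug_value M f g \<pi> h s b \<noteq> \<infinity>"
proof (induction M f g \<pi> h s b rule: aug_value.induct)
  case (1 M f g \<pi> h s b)
  then show ?case
    by (subst aug_value.simps) (auto simp: Let_def sum_Pinfty)
qed

text \<open>With the \<open>i\<close>-th summand split off, the rest is not
  \<open>\<infinity>\<close>, so it cannot outweigh a summand \<open>- \<infinity>\<close>.\<close>

lemma sum_ereal_not_MInfty_imp:
  fixes F :: "'i \<Rightarrow> ereal"
  assumes "finite A" "\<And>i. i \<in> A \<Longrightarrow> F i \<noteq> \<infinity>" "sum F A \<noteq> - \<infinity>" "i \<in> A"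
  shows "F i \<noteq> - \<infinity>"
proof
  assume "F i = - \<infinity>"
  moreover have "sum F A = F i + sum F (A - {i})"
    using assms by (simp add: sum.remove)
  moreover have "sum F (A - {i}) \<noteq> \<infinity>"
    using assms by (auto simp: sum_Pinfty)
  ultimately show False using assms(3) by simp
qed

lemma aug_value_finite_stepD:
  assumes "aug_value M f g \<pi> h s b \<noteq> - \<infinity>" "h \<le> horizon M" "\<pi> h s b = (a, bb)"
  shows "(a, bb) \<in> aug_actions M f g h s b"
    and "\<And>s'. s' \<in> states M \<Longrightarrow> pmf (transition M h s a) s' > 0 \<Longrightarrow>
           aug_value M f g \<pi> (Suc h) s' (bb s') \<noteq> - \<infinity>"
proof -
  let ?p = "pmf (transition M h s a)"
  let ?A = "{s' \<in> states M. ?p s' > 0}"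
  let ?F = "\<lambda>s'. ereal (?p s') * aug_value M f g \<pi> (Suc h) s' (bb s')"
  have value_eq: "aug_value M f g \<pi> h s b =
      (if (a, bb) \<notin> aug_actions M f g h s b then - \<infinity> else ereal (reward M h s a) + sum ?F ?A)"
    using assms(2,3) by (subst aug_value.simps) simp
  then show "(a, bb) \<in> aug_actions M f g h s b"
    using assms(1) by (auto split: if_splits)
  fix s' assume s': "s' \<in> states M" "?p s' > 0"
  \<comment> \<open>The reward is real, so only the sum could make the value
    \<open>- \<infinity>\<close>.\<close>
  have "sum ?F ?A \<noteq> - \<infinity>"
    using value_eq assms(1) by (auto split: if_splits)
  moreover have "finite ?A" by (simp add: states_def)
  moreover have "?F i \<noteq> \<infinity>" if "i \<in> ?A" for i
    using that aug_value_not_PInfty[of M f g \<pi> "Suc h" i "bb i"] by auto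
  ultimately have "?F s' \<noteq> - \<infinity>"
    using s' by (intro sum_ereal_not_MInfty_imp[of ?A ?F]) auto
  \<comment> \<open>A positive real weight times \<open>- \<infinity>\<close> would be
    \<open>- \<infinity>\<close>.\<close>
  then show "aug_value M f g \<pi> (Suc h) s' (bb s') \<noteq> - \<infinity>"
    using s' by auto
qed

lemma aug_cost_le_budget:
  fixes M :: "('a, 'm::finite) camdp"
  assumes "sr_functions (nstates M) f g" "aug_value M f g \<pi> h s b \<noteq> - \<infinity>"
  shows "aug_cost M f g \<pi> h s b \<le> b"
  using assms
\<comment> \<open>This induction varies the budget too, so the hypothesis is available at each
  successor budget \<open>bb s'\<close>.\<close>
proof (induction M f g \<pi> h s b rule: aug_cost.induct)
  case (1 M f g \<pi> h s b)
  show ?case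
  proof (cases "horizon M < h")
    case True
    \<comment> \<open>Past the horizon the cost is \<open>0\<close>, and a value other than
      \<open>- \<infinity>\<close> means \<open>0 \<le> b\<close>.\<close>
    then show ?thesis
      using "1.prems"(2) by (subst aug_cost.simps, subst (asm) aug_value.simps) (simp split: if_splits)
  next
    case False
    obtain a bb where pi: "\<pi> h s b = (a, bb)" by fastforce
    let ?p = "pmf (transition M h s a)"
    note step = aug_value_finite_stepD[OF "1.prems"(2) _ pi]
    \<comment> \<open>Nonnegative weights make scaling preserve the componentwise order.\<close>
    have g: "g 0 = 0" "g (?p s') \<ge> 0" for s'
      using "1.prems"(1) by (auto simp: sr_functions_def Pi_iff pmf_le_1)
    have le: "g (?p s') *\<^sub>R aug_cost M f g \<pi> (Suc h) s' (bb s') \<le> g (?p s') *\<^sub>R bb s'"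
      if "s' \<in> states M" for s'
    proof (cases "?p s' > 0")
      case True
      then have "aug_cost M f g \<pi> (Suc h) s' (bb s') \<le> bb s'"
        using "1.IH"[OF False refl refl "1.prems"(1), of s'] step(2)[OF _ that] False pi by simp
      then show ?thesis using g(2) by (rule scaleR_left_mono)
    next
      \<comment> \<open>The value sums only over successors of positive probability, so it gives no
        bound by \<open>bb s'\<close> here; both sides vanish instead.\<close>
      case False
      then have "?p s' = 0" using pmf_nonneg[of "transition M h s a" s'] by linarith
      then show ?thesis using g(1) by simp
    qed
    have "aug_cost M f g \<pi> h s b = cost M h s a + sr_agg (nstates M) f
        (\<lambda>s'. g (?p s') *\<^sub>R aug_cost M f g \<pi> (Suc h) s' (bb s'))"
      using False pi by (subst aug_cost.simps) simp
    also have "\<dots> \<le> cost M h s a + sr_agg (nstates M) f (\<lambda>s'. g (?p s') *\<^sub>R bb s')"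
      using "1.prems"(1) le
      by (intro add_left_mono sr_agg_mono) (auto simp: sr_functions_def states_def)
    also have "\<dots> \<le> b"
      using step(1) False by (simp add: aug_actions_def)
    finally show ?thesis .
  qed
qed

theorem mainTheorem6:
  fixes M :: "('a, 'm::finite) camdp"
    and f :: "real ^ 'm \<Rightarrow> real ^ 'm \<Rightarrow> real ^ 'm"
    and g :: "real \<Rightarrow> real"
    and \<pi> :: "('a, 'm) aug_policy"
    and h s :: nat
    and b :: "real ^ 'm"
  assumes "is_camdp M"
    and "sr_functions (nstates M) f g"
    and "is_aug_policy M f g \<pi>"
    and "h \<in> {1..horizon M + 1}"
    and "s \<in> states M"
    and "aug_value M f g \<pi> h s b > - \<infinity>"
  shows "aug_cost M f g \<pi> h s b \<le> b"
  using assms(2,6) by (intro aug_cost_le_budget) auto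

end
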